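(* Let $n \in \mathbb{N}$ and let $J_n(1)$ be the finite Jaco graph on vertices $v_1, \dots, v_n$, with prime Jaconian vertex $v_i$. Then $$b_r(J_n(1)) = \sum_{j=1}^{i}\bigl(d^+(v_j) - d^-(v_j)\bigr) + \sum_{j=i+1}^{n}\max\{0, (n-j) - d^-(v_j)\},$$ where $d^+(v_j)$ and $d^-(v_j)$ denote the out-degree and in-degree of $v_j$ in $J_n(1)$ with its defining orientation.
   Context: Infinite Jaco graph $J_\infty(1)$: the directed graph with vertex set $\{v_k : k \in \mathbb{N}\}$ (with $\mathbb{N}=\{1,2,3,\dots\}$), in which every arc goes from a lower-indexed vertex to a higher-indexed one. For $k<\ell$, the arc $(v_k, v_\ell)$ is present if and only if $2k - d^-(v_k) \geq \ell$. Here $d^-(v_k)$ is the in-degree of $v_k$; it depends only on arcs from vertices of smaller index, so the arcs are determined recursively. The finite Jaco graph $J_n(1)$ is the subgraph of $J_\infty(1)$ induced on $v_1, \dots, v_n$, keeping the orientation of its arcs. Let $\Delta(J_n(1))$ be the maximum degree (in-degree plus out-degree) in $J_n(1)$. The prime Jaconian vertex of $J_n(1)$ is the vertex of smallest index whose degree equals $\Delta(J_n(1))$. Brush number. For a finite simple graph, all edges are initially dirty, and each vertex is initially allocated a nonnegative number of brushes. The cleaning process repeatedly takes a vertex whose number of brushes is at least the number of dirty edges incident to it. That vertex sends one brush along each of its incident dirty edges. Each such edge becomes clean, and the neighbour at its other end gains one brush. The brush number $b_r(G)$ of the underlying undirected graph $G$ is the minimum total number of brushes, over all initial allocations, for which every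 edge can eventually be cleaned. Equivalently, $b_r(G) = \min_{\alpha} \sum_{v} \max\{0, d^+_\alpha(v) - d^-_\alpha(v)\}$, where the minimum is over all orientations $\alpha$ of $G$ in which cleaning is possible (the acyclic orientations), and orientations where cleaning is impossible are assigned value $\infty$. Here $b_r(J_n(1))$ means the brush number of the underlying undirected graph of $J_n(1)$. *)

theory Defs
  imports "Graph_Theory.Graph_Theory"
begin

section \<open>Jaco graphs\<close>

text \<open>
  The vertex \<open>v\<^sub>k\<close> is the natural number \<open>k \<ge> 1\<close>.  The in-degree of \<open>v\<^sub>k\<close> in the infinite Jaco
  graph is computed first, by recursion over the smaller indices; the lemma
  \<open>in_degree_jaco_inf\<close> shows that it agrees with the in-degree in the resulting digraph.
  The arc condition \<open>2k - d\<^sup>-(v\<^sub>k) \<ge> l\<close> is written without subtraction.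
\<close>

fun jaco_indeg :: "nat \<Rightarrow> nat" where
  "jaco_indeg k = (\<Sum>j\<in>{1..<k}. if k + jaco_indeg j \<le> 2 * j then 1 else 0)"

declare jaco_indeg.simps [simp del]

definition jaco_inf :: "(nat, nat \<times> nat) pre_digraph" where
  "jaco_inf = \<lparr> verts = {1..}, arcs = {(k, l). 1 \<le> k \<and> k < l \<and> l + jaco_indeg k \<le> 2 * k},
     tail = fst, head = snd \<rparr>"

lemma in_degree_jaco_inf: "in_degree jaco_inf k = jaco_indeg k"
proof -
  have "in_arcs jaco_inf k = (\<lambda>j. (j, k)) ` {j \<in> {1..<k}. k + jaco_indeg j \<le> 2 * j}"
    by (auto simp: in_arcs_def jaco_inf_def)
  then have "in_degree jaco_inf k = card {j \<in> {1..<k}. k + jaco_indeg j \<le> 2 * j}"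
    by (simp add: in_degree_def card_image inj_on_def)
  also have "\<dots> = jaco_indeg k"
    by (subst (2) jaco_indeg.simps) (simp add: sum.If_cases Int_def conj_commute)
  finally show ?thesis .
qed

lemma arcs_jaco_inf_iff:
  "(k, l) \<in> arcs jaco_inf \<longleftrightarrow> 1 \<le> k \<and> k < l \<and> int l \<le> 2 * int k - int (in_degree jaco_inf k)"
  by (auto simp: in_degree_jaco_inf) (auto simp: jaco_inf_def)

definition jaco :: "nat \<Rightarrow> (nat, nat \<times> nat) pre_digraph" where
  "jaco n = jaco_inf \<restriction> {1..n}"

definition total_degree :: "('a, 'b) pre_digraph \<Rightarrow> 'a \<Rightarrow> nat" where
  "total_degree G v = in_degree G v + out_degree G v"

definition max_degree :: "('a, 'b) pre_digraph \<Rightarrow> nat" where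
  "max_degree G = Max (total_degree G ` verts G)"

definition prime_jaconian :: "nat \<Rightarrow> nat" where
  "prime_jaconian n =
     (LEAST i. i \<in> verts (jaco n) \<and> total_degree (jaco n) i = max_degree (jaco n))"

section \<open>Brush number\<close>

text \<open>
  A finite simple graph is given by its vertex set \<open>V\<close> and its set \<open>E\<close> of two-element edges.
  A state of the cleaning process consists of the current number of brushes at every vertex and
  the set of edges that are still dirty.
\<close>

definition dirty_at :: "'a set set \<Rightarrow> 'a \<Rightarrow> 'a set set" where
  "dirty_at D v = {e \<in> D. v \<in> e}"

inductive clean_step ::
  "'a set \<Rightarrow> ('a \<Rightarrow> nat) \<times> 'a set set \<Rightarrow> ('a \<Rightarrow> nat) \<times> 'a set set \<Rightarrow> bool" for V where
  "v \<in> V \<Longrightarrow> card (dirty_at D v) \<le> b v \<Longrightarrow>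
   clean_step V (b, D)
     (\<lambda>u. if u = v then b v - card (dirty_at D v)
          else if {u, v} \<in> D then b u + 1 else b u,
      D - dirty_at D v)"

definition cleanable :: "'a set \<Rightarrow> 'a set set \<Rightarrow> ('a \<Rightarrow> nat) \<Rightarrow> bool" where
  "cleanable V E b \<longleftrightarrow> (\<exists>b'. (clean_step V)\<^sup>*\<^sup>* (b, E) (b', {}))"

definition brush_number :: "'a set \<Rightarrow> 'a set set \<Rightarrow> nat" where
  "brush_number V E = (LEAST m. \<exists>b. cleanable V E b \<and> (\<Sum>v\<in>V. b v) = m)"

definition underlying_edges :: "('a, 'b) pre_digraph \<Rightarrow> 'a set set" where
  "underlying_edges G = (\<lambda>e. {tail G e, head G e}) ` arcs G"

end

theory Submission
  imports Defs
begin

text \<open>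
  When a set \<open>A\<close> of vertices has been fired, every edge between \<open>A\<close> and its complement has
  delivered a brush that is still waiting outside \<open>A\<close>.  Hence the number of brushes is at least the
  largest cut met along the firing order.  In \<open>J\<^sub>n(1)\<close> adjacency is determined by a strictly
  increasing right endpoint \<open>2k - d\<^sup>-(v\<^sub>k)\<close>, so the ends of the edges that leave \<open>{v\<^sub>1, \<dots>, v\<^sub>m}\<close> form
  a clique \<open>L\<close> on the left and a clique \<open>R\<close> on the right.  Along any firing order, at the moment when
  exactly \<open>|L|\<close> vertices of \<open>L \<union> R\<close> have been fired, the cut has at least as many edges as there
  are between \<open>L\<close> and \<open>R\<close>.  Firing \<open>v\<^sub>1, \<dots>, v\<^sub>n\<close> in this order costs the sum of the positive
  parts of \<open>d\<^sup>+ - d\<^sup>-\<close>; since this difference is nonnegative up to some \<open>m\<close> and nonpositive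
  afterwards, the cost is exactly the cut at \<open>m\<close>.
\<close>

section \<open>Cleaning and cuts\<close>

definition simple_edges :: "'a set \<Rightarrow> 'a set set \<Rightarrow> bool" where
  "simple_edges V E \<longleftrightarrow> (\<forall>e\<in>E. \<exists>u\<in>V. \<exists>v\<in>V. u \<noteq> v \<and> e = {u, v})"

definition cut_edges :: "'a set set \<Rightarrow> 'a set \<Rightarrow> 'a set set" where
  "cut_edges E A = {e \<in> E. e \<inter> A \<noteq> {} \<and> \<not> e \<subseteq> A}"

lemma finite_simple_edges:
  assumes "simple_edges V E" "finite V"
  shows "finite E"
proof (rule finite_subset)
  show "E \<subseteq> Pow V" using assms(1) by (fastforce simp: simple_edges_def)
qed (use assms(2) in simp)

lemma card_dirty_at:
  assumes "simple_edges V D"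
  shows "card (dirty_at D v) = card {u. {u, v} \<in> D}"
proof -
  have "dirty_at D v = (\<lambda>u. {u, v}) ` {u. {u, v} \<in> D}"
  proof (intro equalityI subsetI)
    fix e assume e: "e \<in> dirty_at D v"
    then have "e \<in> D" "v \<in> e" by (auto simp: dirty_at_def)
    moreover obtain a b where "e = {a, b}"
      using assms \<open>e \<in> D\<close> by (auto simp: simple_edges_def)
    ultimately have "e = {a, v} \<or> e = {b, v}" by auto
    then show "e \<in> (\<lambda>u. {u, v}) ` {u. {u, v} \<in> D}" using \<open>e \<in> D\<close> by blast
  qed (auto simp: dirty_at_def)
  moreover have "inj (\<lambda>u. {u, v})" by (auto simp: inj_on_def doubleton_eq_iff)
  ultimately show ?thesis by (simp add: card_image inj_on_subset)
qed

text \<open>Every cut edge is charged to its end outside \<open>A\<close>, where the hypothesis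
  provides a separate brush for each edge into \<open>A\<close>.\<close>

lemma card_cut_edges_le_sum:
  assumes "simple_edges V E" "finite V" "A \<subseteq> V"
    and "\<And>v. v \<in> V - A \<Longrightarrow> card {u \<in> A. {u, v} \<in> E} \<le> b v"
  shows "card (cut_edges E A) \<le> (\<Sum>v\<in>V. b v)"
proof -
  have fA: "finite A" using assms finite_subset by blast
  define S where "S = (SIGMA v:V - A. {u \<in> A. {u, v} \<in> E})"
  have "finite S" unfolding S_def using assms(2) fA by auto
  have "cut_edges E A \<subseteq> (\<lambda>(v, u). {u, v}) ` S"
  proof
    fix e assume "e \<in> cut_edges E A"
    then have e: "e \<in> E" "e \<inter> A \<noteq> {}" "\<not> e \<subseteq> A" by (auto simp: cut_edges_def)
    then obtain x y where "x \<in> V" "y \<in> V" "e = {x, y}"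
      using assms(1) unfolding simple_edges_def by blast
    then have "(x, y) \<in> S \<and> e = {y, x} \<or> (y, x) \<in> S \<and> e = {x, y}"
      using e by (auto simp: S_def insert_commute)
    then show "e \<in> (\<lambda>(v, u). {u, v}) ` S" by (auto simp: image_iff)
  qed
  then have "card (cut_edges E A) \<le> card S"
    using \<open>finite S\<close> by (meson card_image_le card_mono finite_imageI le_trans)
  also have "\<dots> = (\<Sum>v\<in>V - A. card {u \<in> A. {u, v} \<in> E})"
    unfolding S_def using assms(2) fA by simp
  also have "\<dots> \<le> (\<Sum>v\<in>V - A. b v)" by (intro sum_mono assms(4)) auto
  also have "\<dots> \<le> (\<Sum>v\<in>V. b v)" using assms(2) by (intro sum_mono2) auto
  finally show ?thesis .
qed

text \<open>The firing vertex loses one brush per neighbour along a dirty edge, and each of these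
  neighbours gains one. The truncated subtraction is exact because firing requires enough
  brushes.\<close>

lemma sum_brushes_clean_step:
  assumes "clean_step V (b, D) (b', D')" "simple_edges V D" "finite V"
  shows "(\<Sum>v\<in>V. b' v) = (\<Sum>v\<in>V. b v)"
  using assms(1)
proof cases
  case (1 v)
  define N where "N = {u. {u, v} \<in> D}"
  have N: "N \<subseteq> V - {v}"
    using assms(2) by (auto simp: N_def simple_edges_def doubleton_eq_iff)
  have c: "card (dirty_at D v) = card N" using card_dirty_at[OF assms(2)] N_def by simp
  have "(\<Sum>u\<in>V. b' u) = b' v + (\<Sum>u\<in>V - {v}. b' u)"
    using assms(3) 1 by (simp add: sum.remove)
  also have "(\<Sum>u\<in>V - {v}. b' u) = (\<Sum>u\<in>V - {v}. b u + of_bool (u \<in> N))"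
    using 1 by (intro sum.cong) (auto simp: N_def)
  also have "\<dots> = (\<Sum>u\<in>V - {v}. b u) + card N"
    using N assms(3) by (simp add: sum.distrib of_bool_def sum.If_cases Int_absorb1)
  also have "b' v = b v - card N" using 1 c by simp
  also have "b v - card N + ((\<Sum>u\<in>V - {v}. b u) + card N) = b v + (\<Sum>u\<in>V - {v}. b u)"
    using 1 c by simp
  also have "\<dots> = (\<Sum>u\<in>V. b u)" using assms(3) 1 by (simp add: sum.remove)
  finally show ?thesis .
qed

text \<open>
  The witness \<open>A\<close> is the set of vertices fired so far; the last conjunct records the cuts of all
  earlier stages, one for each possible number of fired vertices of \<open>W\<close>.
\<close>

lemma clean_steps_invariant:
  assumes "(clean_step V)\<^sup>*\<^sup>* (b, E) s" "simple_edges V E" "finite V"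
  shows "\<exists>A\<subseteq>V. snd s = {e \<in> E. e \<inter> A = {}} \<and> (\<Sum>v\<in>V. fst s v) = (\<Sum>v\<in>V. b v) \<and>
    (\<forall>v\<in>V - A. card {u \<in> A. {u, v} \<in> E} \<le> fst s v) \<and>
    (\<forall>k\<le>card (A \<inter> W). \<exists>A'\<subseteq>V. card (A' \<inter> W) = k \<and> card (cut_edges E A') \<le> (\<Sum>v\<in>V. b v))"
  using assms(1)
proof (induction rule: rtranclp_induct)
  case base
  have "cut_edges E {} = {}" by (auto simp: cut_edges_def)
  then show ?case by (intro exI[of _ "{}"]) (auto intro!: exI[of _ "{}"])
next
  case (step s s')
  obtain b1 D b2 D2 where s: "s = (b1, D)" "s' = (b2, D2)" by fastforce
  from step.IH s obtain A where A: "A \<subseteq> V" "D = {e \<in> E. e \<inter> A = {}}"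
      "(\<Sum>v\<in>V. b1 v) = (\<Sum>v\<in>V. b v)"
    and brushes: "\<And>v. v \<in> V - A \<Longrightarrow> card {u \<in> A. {u, v} \<in> E} \<le> b1 v"
    and cuts: "\<And>k. k \<le> card (A \<inter> W) \<Longrightarrow>
      \<exists>A'\<subseteq>V. card (A' \<inter> W) = k \<and> card (cut_edges E A') \<le> (\<Sum>v\<in>V. b v)"
    by auto
  have fA: "finite A" using A(1) assms(3) finite_subset by blast
  have sD: "simple_edges V D" using assms(2) A(2) by (auto simp: simple_edges_def)
  have total: "(\<Sum>v\<in>V. b2 v) = (\<Sum>v\<in>V. b v)"
    using sum_brushes_clean_step[OF _ sD assms(3)] step.hyps(2) s A(3) by auto
  from step.hyps(2)[unfolded s] show ?case
  proof cases
    case (1 v)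
    show ?thesis
    proof (cases "v \<in> A")
      \<comment> \<open>A vertex may fire again, but all its edges are already clean, so the state
        does not change.\<close>
      case True
      then have "dirty_at D v = {}" and "\<And>u. {u, v} \<notin> D" by (auto simp: dirty_at_def A(2))
      then have "b2 = b1" "D2 = D" using 1 by (auto simp: fun_eq_iff)
      then show ?thesis using A brushes cuts s by auto
    next
      case False
      let ?A = "insert v A"
      have D2: "D2 = {e \<in> E. e \<inter> ?A = {}}" using 1 A(2) by (auto simp: dirty_at_def)
      have brushes': "card {u \<in> ?A. {u, w} \<in> E} \<le> b2 w" if "w \<in> V - ?A" for w
      proof -
        have "{w, v} \<in> D \<longleftrightarrow> {v, w} \<in> E" using that False A(2) by (auto simp: insert_commute)
        then have b2: "b2 w = b1 w + of_bool ({v, w} \<in> E)" using 1 that by auto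
        \<comment> \<open>The second set has at most one element; it matches the brush that
          \<open>w\<close> gains exactly when \<open>{v, w}\<close> is an edge.\<close>
        have "{u \<in> ?A. {u, w} \<in> E} = {u \<in> A. {u, w} \<in> E} \<union> {u. u = v \<and> {v, w} \<in> E}" by auto
        then have "card {u \<in> ?A. {u, w} \<in> E} \<le>
            card {u \<in> A. {u, w} \<in> E} + card {u. u = v \<and> {v, w} \<in> E}"
          by (simp only: card_Un_le)
        also have "\<dots> \<le> b2 w" using brushes[of w] that b2 by (cases "{v, w} \<in> E") auto
        finally show ?thesis .
      qed
      have AV: "?A \<subseteq> V" using A(1) 1 by auto
      have "card (cut_edges E ?A) \<le> (\<Sum>v\<in>V. b2 v)"
        by (rule card_cut_edges_le_sum[OF assms(2,3) AV brushes'])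
      \<comment> \<open>A step adds a single vertex, so the number of fired vertices of
        \<open>W\<close> skips no value.\<close>
      moreover have "card (?A \<inter> W) \<le> Suc (card (A \<inter> W))"
        using fA by (cases "v \<in> W") (auto simp: card_insert_if)
      ultimately have "\<exists>A'\<subseteq>V. card (A' \<inter> W) = k \<and> card (cut_edges E A') \<le> (\<Sum>v\<in>V. b v)"
        if "k \<le> card (?A \<inter> W)" for k
      proof (cases "k \<le> card (A \<inter> W)")
        case False
        then have "k = card (?A \<inter> W)" using that \<open>card (?A \<inter> W) \<le> _\<close> by linarith
        then show ?thesis using AV \<open>card (cut_edges E ?A) \<le> _\<close> total by metis
      qed (rule cuts)
      then show ?thesis using AV D2 total brushes' s by (intro exI[of _ ?A]) auto
    qed
  qed
qed

text \<open>A complete cleaning need not fire every vertex. Values of \<open>k\<close> reached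
  during the run come from the invariant; for larger ones the final set of fired vertices is
  enlarged inside \<open>W\<close>.\<close>

lemma cleanable_cut:
  assumes "cleanable V E b" "simple_edges V E" "finite V" "W \<subseteq> V" "k \<le> card W"
  shows "\<exists>A\<subseteq>V. card (A \<inter> W) = k \<and> card (cut_edges E A) \<le> (\<Sum>v\<in>V. b v)"
proof -
  obtain b' where "(clean_step V)\<^sup>*\<^sup>* (b, E) (b', {})" using assms(1) by (auto simp: cleanable_def)
  from clean_steps_invariant[OF this assms(2,3), of W] obtain A where
    A: "A \<subseteq> V" "{e \<in> E. e \<inter> A = {}} = {}" "(\<Sum>v\<in>V. b' v) = (\<Sum>v\<in>V. b v)"
    and brushes: "\<And>v. v \<in> V - A \<Longrightarrow> card {u \<in> A. {u, v} \<in> E} \<le> b' v"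
    and cuts: "\<And>k. k \<le> card (A \<inter> W) \<Longrightarrow>
      \<exists>A'\<subseteq>V. card (A' \<inter> W) = k \<and> card (cut_edges E A') \<le> (\<Sum>v\<in>V. b v)"
    by auto
  show ?thesis
  proof (cases "k \<le> card (A \<inter> W)")
    case False
    have fW: "finite W" using assms(3,4) finite_subset by blast
    obtain T where T: "A \<inter> W \<subseteq> T" "T \<subseteq> W" "card T = k"
      using exists_subset_between[of "A \<inter> W" k W] False assms(5) fW by auto
    define X where "X = A \<union> T"
    have XW: "X \<inter> W = T" using T by (auto simp: X_def)
    \<comment> \<open>No edge is dirty at the end, so every edge meets \<open>A\<close>, and adding
      vertices to \<open>A\<close> can only remove edges from the cut.\<close>
    have sub: "cut_edges E X \<subseteq> cut_edges E A"
      using A(2) by (auto simp: cut_edges_def X_def)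
    have "finite (cut_edges E A)"
      using finite_simple_edges[OF assms(2,3)] by (simp add: cut_edges_def)
    then have "card (cut_edges E X) \<le> card (cut_edges E A)" by (rule card_mono[OF _ sub])
    also have "\<dots> \<le> (\<Sum>v\<in>V. b' v)"
      by (rule card_cut_edges_le_sum[OF assms(2,3) A(1) brushes])
    finally show ?thesis using A(1,3) T XW assms(4) by (intro exI[of _ X]) (auto simp: X_def)
  qed (rule cuts)
qed

section \<open>Cuts of two cliques joined by edges\<close>

lemma inj_on_doubleton_Times:
  assumes "X \<inter> Y = {}"
  shows "inj_on (\<lambda>(u, v). {u, v}) (X \<times> Y)"
  using assms by (auto simp: inj_on_def doubleton_eq_iff)

text \<open>Let \<open>A\<close> contain \<open>s\<close> vertices of \<open>L\<close> and
  \<open>t\<close> of \<open>R\<close>. Since \<open>s + t\<close> is the size of \<open>L\<close>,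
  exactly \<open>t\<close> vertices of \<open>L\<close> are missing from \<open>A\<close>. At most
  \<open>s * t + t * card (R - A)\<close> edges of \<open>F\<close> escape the cut, and the cut
  edges inside the two cliques number exactly as many.\<close>

lemma card_edges_between_cliques_le_cut:
  assumes E: "finite E" and fin: "finite L" "finite R" and disj: "L \<inter> R = {}"
    and L: "\<And>u v. u \<in> L \<Longrightarrow> v \<in> L \<Longrightarrow> u \<noteq> v \<Longrightarrow> {u, v} \<in> E"
    and R: "\<And>u v. u \<in> R \<Longrightarrow> v \<in> R \<Longrightarrow> u \<noteq> v \<Longrightarrow> {u, v} \<in> E"
    and A: "card (A \<inter> (L \<union> R)) = card L"
    and F: "F \<subseteq> E" "F \<subseteq> (\<lambda>(u, v). {u, v}) ` (L \<times> R)"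
  shows "card F \<le> card (cut_edges E A)"
proof -
  let ?pair = "\<lambda>(u, v). {u, v}"
  define s t where "s = card (L \<inter> A)" and "t = card (R \<inter> A)"
  have "A \<inter> (L \<union> R) = (L \<inter> A) \<union> (R \<inter> A)" by auto
  then have "card L = s + t"
    using A card_Un_disjoint[of "L \<inter> A" "R \<inter> A"] fin disj by (auto simp: s_def t_def)
  moreover have "card L = s + card (L - A)"
    unfolding s_def using card_Int_Diff[OF fin(1)] by simp
  ultimately have t: "card (L - A) = t" by simp
  define C1 C2 where "C1 = ?pair ` ((L \<inter> A) \<times> (L - A))" and "C2 = ?pair ` ((R \<inter> A) \<times> (R - A))"
  have card_C: "card C1 = s * t" "card C2 = t * card (R - A)"
    unfolding C1_def C2_def
    by (subst card_image, auto intro!: inj_on_doubleton_Times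
        simp: s_def t_def t card_cartesian_product)+
  have finC: "finite C1" "finite C2" using fin by (auto simp: C1_def C2_def)
  have inner: "card (C1 \<union> C2) = s * t + t * card (R - A)"
    using disj finC by (subst card_Un_disjoint) (auto simp: card_C, auto simp: C1_def C2_def doubleton_eq_iff)
  \<comment> \<open>An edge of \<open>F\<close> escapes the cut only if both its ends are in
    \<open>A\<close> or both are outside.\<close>
  have "F - cut_edges E A \<subseteq> ?pair ` ((L \<inter> A) \<times> (R \<inter> A)) \<union> ?pair ` ((L - A) \<times> (R - A))"
  proof
    fix e assume e: "e \<in> F - cut_edges E A"
    then obtain u v where uv: "u \<in> L" "v \<in> R" "e = {u, v}" using F(2) by auto
    then have "u \<in> A \<longleftrightarrow> v \<in> A" using e F(1) by (auto simp: cut_edges_def)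
    then have "(u, v) \<in> (L \<inter> A) \<times> (R \<inter> A) \<or> (u, v) \<in> (L - A) \<times> (R - A)" using uv by auto
    then show "e \<in> ?pair ` ((L \<inter> A) \<times> (R \<inter> A)) \<union> ?pair ` ((L - A) \<times> (R - A))"
      using uv(3) by (auto simp: image_iff)
  qed
  then have "card (F - cut_edges E A) \<le>
      card (?pair ` ((L \<inter> A) \<times> (R \<inter> A)) \<union> ?pair ` ((L - A) \<times> (R - A)))"
    using fin by (intro card_mono) auto
  also have "\<dots> \<le> card (?pair ` ((L \<inter> A) \<times> (R \<inter> A))) + card (?pair ` ((L - A) \<times> (R - A)))"
    by (rule card_Un_le)
  also have "\<dots> \<le> card ((L \<inter> A) \<times> (R \<inter> A)) + card ((L - A) \<times> (R - A))"
    using fin by (intro add_mono card_image_le) auto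
  also have "\<dots> = card (C1 \<union> C2)"
    using inner by (simp add: card_cartesian_product s_def t_def t[unfolded t_def])
  finally have uncut: "card (F - cut_edges E A) \<le> card (C1 \<union> C2)" .
  have finF: "finite F" using E F(1) finite_subset by blast
  have "C1 \<union> C2 \<subseteq> cut_edges E A"
    using L R by (auto simp: C1_def C2_def cut_edges_def)
  moreover have "F \<inter> (C1 \<union> C2) = {}"
  proof -
    have "e \<notin> C1 \<union> C2" if e: "e \<in> F" for e
    proof -
      obtain u v where "u \<in> L" "v \<in> R" "e = {u, v}" using subsetD[OF F(2) e] by auto
      then show ?thesis using disj by (auto simp: C1_def C2_def doubleton_eq_iff)
    qed
    then show ?thesis by blast
  qed
  ultimately have "card (F \<inter> cut_edges E A) + card (C1 \<union> C2) = card ((F \<inter> cut_edges E A) \<union> (C1 \<union> C2))"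
    using finF finC by (subst card_Un_disjoint) auto
  also have "\<dots> \<le> card (cut_edges E A)"
    using \<open>C1 \<union> C2 \<subseteq> cut_edges E A\<close> E by (intro card_mono) (auto simp: cut_edges_def)
  finally have "card (F \<inter> cut_edges E A) + card (C1 \<union> C2) \<le> card (cut_edges E A)" .
  then show ?thesis using uncut card_Int_Diff[OF finF, of "cut_edges E A"] by linarith
qed

section \<open>Firing the vertices in index order\<close>

lemma cleanable_natural_order:
  assumes E: "simple_edges {1..n} E"
    and b: "\<And>v. v \<in> {1..n} \<Longrightarrow> card {u. v < u \<and> {u, v} \<in> E} \<le> b v + card {u. u < v \<and> {u, v} \<in> E}"
  shows "cleanable {1..n::nat} E b"
proof -
  have verts: "u \<in> {1..n}" if "{u, v} \<in> E" for u v
    using E that by (fastforce simp: simple_edges_def doubleton_eq_iff)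
  \<comment> \<open>After \<open>1, ..., k\<close> have fired, each later vertex has gained one
    brush from each of its neighbours up to \<open>k\<close>. When \<open>Suc k\<close> fires, its
    dirty edges therefore lead exactly to larger vertices, and the assumption on \<open>b\<close>
    supplies the brushes.\<close>
  have "\<exists>b'. (clean_step {1..n})\<^sup>*\<^sup>* (b, E) (b', {e \<in> E. e \<inter> {1..k} = {}}) \<and>
      (\<forall>v>k. b' v = b v + card {u. u \<le> k \<and> {u, v} \<in> E})" if "k \<le> n" for k
    using that
  proof (induction k)
    case 0
    \<comment> \<open>Vertices start at 1, so 0 is not an end of any edge.\<close>
    have "{u. u \<le> 0 \<and> {u, v} \<in> E} = {}" for v using verts by fastforce
    then show ?case by auto
  next
    case (Suc k)
    define D where "D = {e \<in> E. e \<inter> {1..k} = {}}"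
    define v where "v = Suc k"
    obtain b' where b': "(clean_step {1..n})\<^sup>*\<^sup>* (b, E) (b', D)"
      and brushes: "\<And>v. v > k \<Longrightarrow> b' v = b v + card {u. u \<le> k \<and> {u, v} \<in> E}"
      using Suc unfolding D_def by auto
    have "simple_edges {1..n} D" using E by (auto simp: D_def simple_edges_def)
    then have "card (dirty_at D v) = card {u. {u, v} \<in> D}" by (rule card_dirty_at)
    also have "{u. {u, v} \<in> D} = {u. v < u \<and> {u, v} \<in> E}"
    proof -
      have "{u, v} \<in> D \<longleftrightarrow> v < u \<and> {u, v} \<in> E" for u
      proof -
        have "u \<noteq> v" if "{u, v} \<in> E" using E that by (auto simp: simple_edges_def doubleton_eq_iff)
        then show ?thesis using verts[of u v] by (auto simp: D_def v_def)
      qed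
      then show ?thesis by auto
    qed
    also have "card \<dots> \<le> b v + card {u. u < v \<and> {u, v} \<in> E}"
      using b[of v] Suc.prems by (auto simp: v_def)
    also have "\<dots> = b' v" using brushes[of v] by (simp add: v_def less_Suc_eq_le)
    finally have enough: "card (dirty_at D v) \<le> b' v" .
    let ?b = "\<lambda>u. if u = v then b' v - card (dirty_at D v) else if {u, v} \<in> D then b' u + 1 else b' u"
    have "clean_step {1..n} (b', D) (?b, D - dirty_at D v)"
      using enough Suc.prems by (intro clean_step.intros) (auto simp: v_def)
    moreover have "D - dirty_at D v = {e \<in> E. e \<inter> {1..Suc k} = {}}"
      by (auto simp: D_def dirty_at_def v_def atLeastAtMostSuc_conv)
    ultimately have "(clean_step {1..n})\<^sup>*\<^sup>* (b, E) (?b, {e \<in> E. e \<inter> {1..Suc k} = {}})"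
      using b' by auto
    moreover have "?b w = b w + card {u. u \<le> Suc k \<and> {u, w} \<in> E}" if "w > Suc k" for w
    proof -
      have D: "{w, v} \<in> D \<longleftrightarrow> {v, w} \<in> E" using that by (auto simp: D_def v_def insert_commute)
      have "{u. u \<le> Suc k \<and> {u, w} \<in> E} =
          (if {v, w} \<in> E then insert v {u. u \<le> k \<and> {u, w} \<in> E} else {u. u \<le> k \<and> {u, w} \<in> E})"
        by (auto simp: v_def le_Suc_eq)
      then have "card {u. u \<le> Suc k \<and> {u, w} \<in> E} =
          card {u. u \<le> k \<and> {u, w} \<in> E} + of_bool ({v, w} \<in> E)"
        by (auto simp: v_def)
      then show ?thesis using that brushes[of w] D by (auto simp: v_def)
    qed
    ultimately show ?case by blast
  qed
  from this[of n] obtain b' where "(clean_step {1..n})\<^sup>*\<^sup>* (b, E) (b', {e \<in> E. e \<inter> {1..n} = {}})"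
    by auto
  moreover have "{e \<in> E. e \<inter> {1..n} = {}} = {}" using E by (auto simp: simple_edges_def)
  ultimately show ?thesis unfolding cleanable_def by metis
qed

section \<open>Degrees in Jaco graphs\<close>

lemma jaco_indeg_card: "jaco_indeg k = card {j \<in> {1..<k}. k + jaco_indeg j \<le> 2 * j}"
  by (subst jaco_indeg.simps) (simp add: sum.If_cases Int_def conj_commute)

text \<open>An arc from \<open>j\<close> to \<open>k\<close> forces \<open>2 * j\<close> to be at
  least \<open>k\<close>, so only the upper half of the smaller indices can contribute. This also
  makes \<open>2 * k - jaco_indeg k\<close> an exact subtraction with value at least
  \<open>k\<close>.\<close>

lemma jaco_indeg_le_half: "2 * jaco_indeg k \<le> k"
proof -
  have "jaco_indeg k \<le> card {(k + 1) div 2..<k}"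
    unfolding jaco_indeg_card[of k] by (intro card_mono) auto
  then show ?thesis by simp
qed

text \<open>From \<open>k\<close> to \<open>Suc k\<close> the set of in-neighbours gains
  \<open>k\<close> and loses the \<open>j\<close> whose right endpoint
  \<open>2 * j - jaco_indeg j\<close> is exactly \<open>k\<close>. By induction right endpoints are
  strictly increasing below \<open>k\<close>, so at most one such \<open>j\<close> exists.\<close>

lemma jaco_indeg_Suc:
  assumes "1 \<le> k"
  shows "jaco_indeg k \<le> jaco_indeg (Suc k) \<and> jaco_indeg (Suc k) \<le> Suc (jaco_indeg k)"
  using assms
proof (induction k rule: less_induct)
  case (less k)
  define S where "S = {j \<in> {1..<k}. k + jaco_indeg j \<le> 2 * j}"
  define T where "T = {j \<in> S. k + jaco_indeg j = 2 * j}"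
  have fin: "finite S" "finite T" by (auto simp: S_def T_def)
  \<comment> \<open>If \<open>a\<close> and \<open>b\<close> in \<open>T\<close> had the same right
    endpoint with \<open>a < b\<close>, the in-degree would grow by \<open>2 * (b - a)\<close>,
    whereas this bound allows only \<open>b - a\<close>.\<close>
  have growth: "jaco_indeg b + a \<le> jaco_indeg a + b" if "a \<le> b" "1 \<le> a" "b < k" for a b
    using that
  proof (induction b rule: dec_induct)
    case (step b)
    then have "jaco_indeg (Suc b) \<le> Suc (jaco_indeg b)" using less.IH[of b] by auto
    then show ?case using step by auto
  qed simp
  have "a = b" if "a \<in> T" "b \<in> T" for a b
    using that
  proof (induction a b rule: linorder_wlog)
    case (le a b)
    then show ?case using growth[of a b] by (auto simp: T_def S_def)
  qed simp
  then have T: "card T \<le> 1" using fin(2) by (simp add: card_le_Suc0_iff_eq)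
  \<comment> \<open>Consecutive vertices are adjacent, so \<open>k\<close> is an in-neighbour of
    \<open>Suc k\<close>.\<close>
  have "Suc k + jaco_indeg k \<le> 2 * k"
    using jaco_indeg_le_half[of k] less.prems by linarith
  then have "{j \<in> {1..<Suc k}. Suc k + jaco_indeg j \<le> 2 * j} = insert k (S - T)"
    using less.prems by (auto simp: S_def T_def less_Suc_eq)
  then have "jaco_indeg (Suc k) = card (insert k (S - T))" using jaco_indeg_card[of "Suc k"] by simp
  also have "\<dots> = Suc (card (S - T))"
    using fin by (subst card_insert_disjoint) (auto simp: S_def)
  also have "card (S - T) = card S - card T" using fin by (intro card_Diff_subset) (auto simp: T_def)
  finally have "jaco_indeg (Suc k) = Suc (card S - card T)" .
  moreover have "jaco_indeg k = card S" unfolding S_def by (rule jaco_indeg_card)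
  moreover have "card T \<le> card S" using fin by (intro card_mono) (auto simp: T_def)
  ultimately show ?case using T by auto
qed

text \<open>Summing the one-step bounds. The second inequality makes the right endpoint strictly
  increasing.\<close>

lemma jaco_indeg_mono_diff:
  assumes "1 \<le> a" "a \<le> b"
  shows "jaco_indeg a \<le> jaco_indeg b \<and> jaco_indeg b + a \<le> jaco_indeg a + b"
  using assms(2)
proof (induction b rule: dec_induct)
  case (step b)
  then show ?case using jaco_indeg_Suc[of b] assms(1) by auto
qed simp

section \<open>Degrees in the finite graph and the prime Jaconian vertex\<close>

lemma verts_jaco: "verts (jaco n) = {1..n}"
  by (simp add: jaco_def)

lemma arcs_jaco: "arcs (jaco n) = {(a, b). 1 \<le> a \<and> a < b \<and> b \<le> n \<and> b + jaco_indeg a \<le> 2 * a}"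
  by (auto simp: jaco_def induce_subgraph_def jaco_inf_def)

lemma finite_arcs_jaco: "finite (arcs (jaco n))"
  by (rule finite_subset[of _ "{1..n} \<times> {1..n}"]) (auto simp: arcs_jaco)

lemma tail_head_jaco: "tail (jaco n) = fst" "head (jaco n) = snd"
  by (auto simp: jaco_def induce_subgraph_def jaco_inf_def)

lemma in_degree_jaco:
  assumes "j \<le> n"
  shows "in_degree (jaco n) j = jaco_indeg j"
proof -
  have "in_arcs (jaco n) j = in_arcs jaco_inf j"
    using assms by (auto simp: in_arcs_def tail_head_jaco arcs_jaco) (auto simp: jaco_inf_def)
  then show ?thesis using in_degree_jaco_inf by (simp add: in_degree_def)
qed

lemma out_degree_jaco:
  assumes "1 \<le> j"
  shows "out_degree (jaco n) j = min n (2 * j - jaco_indeg j) - j"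
proof -
  have "jaco_indeg j \<le> 2 * j" using jaco_indeg_le_half[of j] by simp
  then have "out_arcs (jaco n) j = Pair j ` {j<..min n (2 * j - jaco_indeg j)}"
    using assms by (auto simp: out_arcs_def tail_head_jaco arcs_jaco)
  then show ?thesis by (simp add: out_degree_def card_image inj_on_def)
qed

text \<open>Let \<open>k\<close> be the last index whose right endpoint is at most \<open>n\<close>.
  Up to \<open>k\<close> the degree of \<open>j\<close> is \<open>j\<close>. Past \<open>k\<close>
  it is \<open>n - j + jaco_indeg j\<close>, which never increases with \<open>j\<close> and is at
  most \<open>k\<close> at \<open>Suc k\<close>. So the maximum degree is \<open>k\<close>, first
  attained at \<open>k\<close>.\<close>

lemma prime_jaconian_bounds:
  assumes "2 \<le> n"
  shows "prime_jaconian n \<in> {1..n}"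
    and "\<And>j. 1 \<le> j \<Longrightarrow> j \<le> prime_jaconian n \<Longrightarrow> 2 * j - jaco_indeg j \<le> n"
    and "\<And>j. prime_jaconian n < j \<Longrightarrow> n < 2 * j - jaco_indeg j"
proof -
  let ?r = "\<lambda>j. 2 * j - jaco_indeg j"
  have half: "2 * jaco_indeg j \<le> j" for j by (rule jaco_indeg_le_half)
  have le_r: "j \<le> ?r j" for j using half[of j] by linarith
  have r_mono: "?r a < ?r b" if "1 \<le> a" "a < b" for a b
    using jaco_indeg_mono_diff[of a b] that half[of a] half[of b] by linarith
  define k where "k = Max {j \<in> {1..n}. ?r j \<le> n}"
  \<comment> \<open>The right endpoint of 1 is 2, which is where \<open>2 <= n\<close>
    enters.\<close>
  have "1 \<in> {j \<in> {1..n}. ?r j \<le> n}" using assms by auto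
  then have "k \<in> {j \<in> {1..n}. ?r j \<le> n}" unfolding k_def by (intro Max_in) auto
  then have k: "k \<in> {1..n}" "?r k \<le> n" by auto
  have above: "n < ?r j" if "k < j" for j
  proof (rule ccontr)
    assume "\<not> n < ?r j"
    then have "j \<in> {j \<in> {1..n}. ?r j \<le> n}" using that le_r[of j] k(1) by auto
    then have "j \<le> k" unfolding k_def by (intro Max_ge) auto
    then show False using that by simp
  qed
  have below: "?r j \<le> n" if "1 \<le> j" "j \<le> k" for j
    using r_mono[of j k] that k(2) by (cases "j = k") auto
  have deg_below: "total_degree (jaco n) j = j" if "1 \<le> j" "j \<le> k" for j
    using below[OF that] that k(1) half[of j]
    by (simp add: total_degree_def in_degree_jaco out_degree_jaco)
  have deg_above: "total_degree (jaco n) j \<le> k" if "k < j" "j \<le> n" for j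
  proof -
    have "total_degree (jaco n) j + j = jaco_indeg j + n"
      using above[OF that(1)] that by (simp add: total_degree_def in_degree_jaco out_degree_jaco)
    moreover have "jaco_indeg j + Suc k \<le> jaco_indeg (Suc k) + j"
      using jaco_indeg_mono_diff[of "Suc k" j] that by simp
    moreover have "n + jaco_indeg (Suc k) < 2 * Suc k" using above[of "Suc k"] by linarith
    ultimately show ?thesis by simp
  qed
  have "max_degree (jaco n) = k"
    unfolding max_degree_def verts_jaco
  proof (rule Max_eqI)
    fix y assume "y \<in> total_degree (jaco n) ` {1..n}"
    then obtain j where "j \<in> {1..n}" "y = total_degree (jaco n) j" by blast
    then show "y \<le> k" using deg_below[of j] deg_above[of j] by (cases "j \<le> k") auto
  next
    show "k \<in> total_degree (jaco n) ` {1..n}" using deg_below[of k] k(1) by force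
  qed simp
  then have "prime_jaconian n = k"
    unfolding prime_jaconian_def verts_jaco
  proof (intro Least_equality)
    fix y assume "y \<in> {1..n} \<and> total_degree (jaco n) y = max_degree (jaco n)"
    then show "k \<le> y" using deg_below[of y] \<open>max_degree (jaco n) = k\<close> by (cases "y \<le> k") auto
  qed (use k deg_below in auto)
  then show "prime_jaconian n \<in> {1..n}"
    and "\<And>j. 1 \<le> j \<Longrightarrow> j \<le> prime_jaconian n \<Longrightarrow> 2 * j - jaco_indeg j \<le> n"
    and "\<And>j. prime_jaconian n < j \<Longrightarrow> n < 2 * j - jaco_indeg j"
    using k below above by auto
qed

section \<open>The brush number of a Jaco graph\<close>

lemma underlying_edges_jaco_iff:
  "u < v \<Longrightarrow> {u, v} \<in> underlying_edges (jaco n) \<longleftrightarrow> (u, v) \<in> arcs (jaco n)"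
  by (auto simp: underlying_edges_def tail_head_jaco doubleton_eq_iff image_iff arcs_jaco)

lemma simple_edges_jaco: "simple_edges {1..n} (underlying_edges (jaco n))"
  unfolding simple_edges_def
proof
  fix e assume "e \<in> underlying_edges (jaco n)"
  then obtain a b where "e = {a, b}" "1 \<le> a" "a < b" "b \<le> n"
    by (auto simp: underlying_edges_def tail_head_jaco arcs_jaco)
  then show "\<exists>u\<in>{1..n}. \<exists>v\<in>{1..n}. u \<noteq> v \<and> e = {u, v}"
    by (intro bexI[of _ a] bexI[of _ b]) auto
qed

lemma out_degree_jaco_neighbours:
  "card {u. v < u \<and> {u, v} \<in> underlying_edges (jaco n)} = out_degree (jaco n) v"
proof -
  have "out_arcs (jaco n) v = Pair v ` {u. v < u \<and> {u, v} \<in> underlying_edges (jaco n)}"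
    using underlying_edges_jaco_iff[of v _ n]
    by (auto simp: out_arcs_def tail_head_jaco insert_commute image_iff) (auto simp: arcs_jaco)
  then show ?thesis by (simp add: out_degree_def card_image inj_on_def)
qed

lemma in_degree_jaco_neighbours:
  "card {u. u < v \<and> {u, v} \<in> underlying_edges (jaco n)} = in_degree (jaco n) v"
proof -
  have "in_arcs (jaco n) v = (\<lambda>u. (u, v)) ` {u. u < v \<and> {u, v} \<in> underlying_edges (jaco n)}"
    using underlying_edges_jaco_iff[of _ v n]
    by (auto simp: in_arcs_def tail_head_jaco image_iff) (auto simp: arcs_jaco)
  then show ?thesis by (simp add: in_degree_def card_image inj_on_def)
qed

text \<open>Arcs go upwards, so an arc ending in \<open>{1..m}\<close> also starts there and its two
  contributions cancel. Only the arcs leaving \<open>{1..m}\<close> remain.\<close>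

lemma sum_degree_difference_eq_cut:
  "(\<Sum>j=1..m. int (out_degree (jaco n) j) - int (in_degree (jaco n) j)) =
    int (card {(a, b) \<in> arcs (jaco n). a \<le> m \<and> m < b})"
proof -
  let ?X = "{(a, b) \<in> arcs (jaco n). a \<le> m}" and ?Y = "{(a, b) \<in> arcs (jaco n). b \<le> m}"
  have fin: "finite ?X" "finite ?Y"
    by (rule finite_subset[OF _ finite_arcs_jaco[of n]], auto)+
  have "(\<Sum>j=1..m. out_degree (jaco n) j) = card (\<Union>j\<in>{1..m}. out_arcs (jaco n) j)"
    unfolding out_degree_def
    by (subst card_UN_disjoint) (auto simp: out_arcs_def finite_arcs_jaco)
  also have "(\<Union>j\<in>{1..m}. out_arcs (jaco n) j) = ?X"
    by (auto simp: out_arcs_def tail_head_jaco arcs_jaco)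
  finally have out: "(\<Sum>j=1..m. out_degree (jaco n) j) = card ?X" .
  have "(\<Sum>j=1..m. in_degree (jaco n) j) = card (\<Union>j\<in>{1..m}. in_arcs (jaco n) j)"
    unfolding in_degree_def
    by (subst card_UN_disjoint) (auto simp: in_arcs_def finite_arcs_jaco)
  also have "(\<Union>j\<in>{1..m}. in_arcs (jaco n) j) = ?Y"
    by (auto simp: in_arcs_def tail_head_jaco arcs_jaco)
  finally have incoming: "(\<Sum>j=1..m. in_degree (jaco n) j) = card ?Y" .
  have "?Y \<subseteq> ?X" by (auto simp: arcs_jaco)
  moreover have "{(a, b) \<in> arcs (jaco n). a \<le> m \<and> m < b} = ?X - ?Y" by auto
  ultimately have "int (card {(a, b) \<in> arcs (jaco n). a \<le> m \<and> m < b}) = int (card ?X) - int (card ?Y)"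
    using fin by (simp add: card_Diff_subset card_mono)
  then show ?thesis using out incoming by (simp add: sum_subtractf flip: of_nat_sum)
qed

lemma jaco_cut_le_brushes:
  assumes "cleanable {1..n} (underlying_edges (jaco n)) b" "1 \<le> m" "m \<le> n"
  shows "card {(a, b) \<in> arcs (jaco n). a \<le> m \<and> m < b} \<le> (\<Sum>v\<in>{1..n}. b v)"
proof -
  let ?E = "underlying_edges (jaco n)"
  define C where "C = {(a, b) \<in> arcs (jaco n). a \<le> m \<and> m < b}"
  \<comment> \<open>A vertex of \<open>L\<close> reaches beyond \<open>m\<close>, hence every later
    vertex of \<open>L\<close>. A vertex of \<open>R\<close> has a larger right endpoint than
    \<open>m\<close>, hence reaches every later vertex of \<open>R\<close>. So both are
    cliques.\<close>
  define L where "L = {a \<in> {1..m}. Suc m + jaco_indeg a \<le> 2 * a}"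
  define R where "R = {b \<in> {Suc m..n}. b + jaco_indeg m \<le> 2 * m}"
  have C_sub: "C \<subseteq> L \<times> R"
  proof clarify
    fix a b assume "(a, b) \<in> C"
    then have ab: "1 \<le> a" "a \<le> m" "m < b" "b \<le> n" "b + jaco_indeg a \<le> 2 * a"
      by (auto simp: C_def arcs_jaco)
    then show "a \<in> L \<and> b \<in> R"
      using jaco_indeg_mono_diff[of a m] by (auto simp: L_def R_def)
  qed
  have edge: "{u, v} \<in> ?E" if "u < v" "1 \<le> u" "v \<le> n" "v + jaco_indeg u \<le> 2 * u" for u v
    using that underlying_edges_jaco_iff[of u v n] by (simp add: arcs_jaco)
  have L: "{u, v} \<in> ?E" if "u \<in> L" "v \<in> L" "u \<noteq> v" for u v
    using that
  proof (induction u v rule: linorder_wlog)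
    case (le u v)
    then show ?case using assms(3) by (intro edge) (auto simp: L_def)
  qed (simp add: insert_commute)
  have R: "{u, v} \<in> ?E" if "u \<in> R" "v \<in> R" "u \<noteq> v" for u v
    using that
  proof (induction u v rule: linorder_wlog)
    case (le u v)
    then show ?case
      using assms(2) jaco_indeg_mono_diff[of m u] by (intro edge) (auto simp: R_def)
  qed (simp add: insert_commute)
  have LR: "L \<inter> R = {}" "finite L" "finite R" "L \<union> R \<subseteq> {1..n}"
    using assms(2,3) by (auto simp: L_def R_def)
  have fE: "finite ?E" using finite_simple_edges[OF simple_edges_jaco] by simp
  have "card L \<le> card (L \<union> R)" using LR by (intro card_mono) auto
  then obtain A where A: "card (A \<inter> (L \<union> R)) = card L"
      "card (cut_edges ?E A) \<le> (\<Sum>v\<in>{1..n}. b v)"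
    using cleanable_cut[OF assms(1) simple_edges_jaco _ LR(4)] by auto
  have "inj_on (\<lambda>(u, v). {u, v}) C"
    using inj_on_doubleton_Times[OF LR(1)] C_sub inj_on_subset by blast
  then have "card C = card ((\<lambda>(u, v). {u, v}) ` C)" by (simp add: card_image)
  also have "\<dots> \<le> card (cut_edges ?E A)"
  proof (rule card_edges_between_cliques_le_cut[OF fE LR(2,3,1) L R A(1)])
    show "(\<lambda>(u, v). {u, v}) ` C \<subseteq> ?E"
      using underlying_edges_jaco_iff by (auto simp: C_def)
    show "(\<lambda>(u, v). {u, v}) ` C \<subseteq> (\<lambda>(u, v). {u, v}) ` (L \<times> R)" using C_sub by blast
  qed
  finally show ?thesis using A(2) by (simp add: C_def)
qed

theorem theorem2p1:
  fixes n i :: nat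
  assumes "n \<ge> 1"
    and "i = prime_jaconian n"
  shows "int (brush_number (verts (jaco n)) (underlying_edges (jaco n))) =
    (\<Sum>j=1..i. int (out_degree (jaco n) j) - int (in_degree (jaco n) j)) +
    (\<Sum>j=i+1..n. max 0 ((int n - int j) - int (in_degree (jaco n) j)))"
proof -
  let ?E = "underlying_edges (jaco n)"
  define f where "f j = int (out_degree (jaco n) j) - int (in_degree (jaco n) j)" for j
  have i: "i \<in> {1..n}" and f_low: "\<And>j. j \<in> {1..i} \<Longrightarrow> 0 \<le> f j"
    and f_high: "\<And>j. j \<in> {i+1..n} \<Longrightarrow> f j = int n - int j - int (in_degree (jaco n) j)"
  proof -
    have *: "i \<in> {1..n} \<and> (\<forall>j\<in>{1..i}. 0 \<le> f j) \<and>
      (\<forall>j\<in>{i+1..n}. f j = int n - int j - int (in_degree (jaco n) j))"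
    \<comment> \<open>For \<open>n = 1\<close> the prime Jaconian vertex is 1 although its right
      endpoint 2 exceeds \<open>n\<close>, so \<open>prime_jaconian_bounds\<close> does not cover
      this case.\<close>
    proof (cases "n = 1")
      case True
      have "max_degree (jaco 1) = total_degree (jaco 1) 1"
        by (simp add: max_degree_def verts_jaco)
      then have "prime_jaconian 1 = 1"
        unfolding prime_jaconian_def verts_jaco by (intro Least_equality) auto
      moreover have "f 1 = 0"
        using jaco_indeg_le_half[of 1] True by (simp add: f_def in_degree_jaco out_degree_jaco)
      ultimately show ?thesis using True assms(2) by simp
    next
      case False
      then have n: "2 \<le> n" using assms(1) by simp
      note b = prime_jaconian_bounds[OF n, folded assms(2)]
      have "0 \<le> f j" if "j \<in> {1..i}" for j
        using b(2)[of j] that b(1) jaco_indeg_le_half[of j]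
        by (simp add: f_def in_degree_jaco out_degree_jaco)
      moreover have "f j = int n - int j - int (in_degree (jaco n) j)" if "j \<in> {i+1..n}" for j
        using b(3)[of j] that b(1) by (simp add: f_def out_degree_jaco of_nat_diff)
      ultimately show ?thesis using b(1) by blast
    qed
    then show "i \<in> {1..n}" and "\<And>j. j \<in> {1..i} \<Longrightarrow> 0 \<le> f j"
      and "\<And>j. j \<in> {i+1..n} \<Longrightarrow> f j = int n - int j - int (in_degree (jaco n) j)" by auto
  qed
  \<comment> \<open>The optimal cut lies at the last index with nonnegative difference, which may be
    beyond \<open>i\<close>; the positive terms of the second sum come from the indices between
    them.\<close>
  define m where "m = Max {j \<in> {1..n}. 0 \<le> f j}"
  have "i \<in> {j \<in> {1..n}. 0 \<le> f j}" using i f_low by auto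
  then have "m \<in> {j \<in> {1..n}. 0 \<le> f j}" unfolding m_def by (intro Max_in) auto
  moreover have "i \<le> m"
    unfolding m_def using \<open>i \<in> {j \<in> {1..n}. 0 \<le> f j}\<close> by (intro Max_ge) auto
  ultimately have m: "m \<in> {1..n}" "0 \<le> f m" "i \<le> m" by auto
  have neg: "f j < 0" if "j \<in> {m+1..n}" for j
  proof (rule ccontr)
    assume "\<not> f j < 0"
    then have "j \<le> m" unfolding m_def using that by (intro Max_ge) auto
    then show False using that by simp
  qed
  have nonneg: "0 \<le> f j" if "j \<in> {1..m}" for j
  proof (cases "j \<le> i")
    case False
    \<comment> \<open>Past \<open>i\<close> the difference is \<open>n - j\<close> minus the
      in-degree, and the in-degree never decreases, so the difference decreases.\<close>
    then have "f m \<le> f j"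
      using that f_high[of j] f_high[of m] m(1) jaco_indeg_mono_diff[of j m]
      by (auto simp: in_degree_jaco)
    then show ?thesis using m(2) by simp
  qed (use f_low that in simp)
  define c where "c = card {(a, b) \<in> arcs (jaco n). a \<le> m \<and> m < b}"
  \<comment> \<open>The fewest brushes with which firing in index order succeeds; their total is the
    cut at \<open>m\<close>.\<close>
  define b where "b v = nat (f v)" for v
  have "int (\<Sum>v\<in>{1..n}. b v) = (\<Sum>v\<in>{1..n}. max 0 (f v))"
    unfolding of_nat_sum b_def by (intro sum.cong) auto
  also have "\<dots> = (\<Sum>v\<in>{1..m}. max 0 (f v)) + (\<Sum>v\<in>{m+1..n}. max 0 (f v))"
    using m(1) sum.ub_add_nat[of 1 m "\<lambda>v. max 0 (f v)" "n - m"] by simp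
  also have "\<dots> = (\<Sum>v\<in>{1..m}. f v)"
    using sum.neutral[of "{m+1..n}" "\<lambda>v. max 0 (f v)"] neg nonneg
    by (simp add: max_absorb1 max_absorb2 less_imp_le)
  also have "\<dots> = int c" unfolding f_def c_def by (rule sum_degree_difference_eq_cut)
  finally have sum_b: "(\<Sum>v\<in>{1..n}. b v) = c" by linarith
  have "brush_number {1..n} ?E = c"
    unfolding brush_number_def
  proof (rule Least_equality)
    have "cleanable {1..n} ?E b"
      by (rule cleanable_natural_order[OF simple_edges_jaco])
        (auto simp: out_degree_jaco_neighbours in_degree_jaco_neighbours b_def f_def)
    then show "\<exists>b. cleanable {1..n} ?E b \<and> (\<Sum>v\<in>{1..n}. b v) = c" using sum_b by blast
  next
    fix y assume "\<exists>b. cleanable {1..n} ?E b \<and> (\<Sum>v\<in>{1..n}. b v) = y"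
    then show "c \<le> y" using jaco_cut_le_brushes[of n _ m] m(1) by (auto simp: c_def)
  qed
  then have "int (brush_number (verts (jaco n)) ?E) = (\<Sum>v\<in>{1..n}. max 0 (f v))"
    using sum_b \<open>int (\<Sum>v\<in>{1..n}. b v) = (\<Sum>v\<in>{1..n}. max 0 (f v))\<close> by (simp add: verts_jaco)
  \<comment> \<open>The same total is now split at \<open>i\<close> instead of \<open>m\<close>,
    since the out-degree is known to be \<open>n - v\<close> only past \<open>i\<close>.\<close>
  also have "\<dots> = (\<Sum>v\<in>{1..i}. max 0 (f v)) + (\<Sum>v\<in>{i+1..n}. max 0 (f v))"
    using i sum.ub_add_nat[of 1 i "\<lambda>v. max 0 (f v)" "n - i"] by simp
  also have "(\<Sum>v\<in>{1..i}. max 0 (f v)) = (\<Sum>v\<in>{1..i}. f v)" using f_low by (simp add: max_def)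
  also have "(\<Sum>v\<in>{i+1..n}. max 0 (f v)) =
      (\<Sum>v\<in>{i+1..n}. max 0 (int n - int v - int (in_degree (jaco n) v)))"
    by (intro sum.cong) (simp_all only: f_high)
  finally show ?thesis by (simp only: f_def)
qed

end
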